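(* Let $g\ge 1$ be an integer. For all vectors $x=(x_1,\dots,x_g)$ and $y=(y_1,\dots,y_g)$ in $\mathbb{C}^g$ and all integers $d\ge 1$, $$\int_{U(d)^g}\det\Big(I_d+\sum_{j=1}^g x_jU_j\Big)\,\overline{\det\Big(I_d+\sum_{j=1}^g y_jU_j\Big)}\,d\mathcal{U}=\sum_{n=0}^d\ \sum_{|\alpha|=n}c(d,\alpha)\binom{n}{\alpha}x^\alpha\,\overline{y^\alpha},$$ where, for $|\alpha|=n$, $$c(d,\alpha)=\binom{d}{n}\binom{n}{\alpha}\prod_{j=1}^g\binom{d}{\alpha_j}^{-1}.$$
   Context: $U(d)$ is the group of $d\times d$ complex unitary matrices with its normalized Haar probability measure, and $d\mathcal{U}=dU_1\times\cdots\times dU_g$ is the $g$-fold product of this measure on $U(d)^g$, with $\mathcal{U}=(U_1,\dots,U_g)$. A multi-index is $\alpha=(\alpha_1,\dots,\alpha_g)$ with nonnegative integer entries; $|\alpha|=\alpha_1+\cdots+\alpha_g$, $x^\alpha=x_1^{\alpha_1}\cdots x_g^{\alpha_g}$, and $\binom{n}{\alpha}=\frac{n!}{\alpha_1!\cdots\alpha_g!}$ when $|\alpha|=n$. The inner sum is over all multi-indices $\alpha$ of length $g$ with $|\alpha|=n$. *)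

theory Defs
  imports "HOL-Probability.Probability"
begin

definition adjoint_matrix :: "complex^'m^'n \<Rightarrow> complex^'n^'m" where
  "adjoint_matrix A = map_matrix cnj (transpose A)"

definition unitary_group :: "(complex^'d^'d) set" where
  "unitary_group = {U. adjoint_matrix U ** U = mat 1 \<and> U ** adjoint_matrix U = mat 1}"

text \<open>
  Normalized Haar measure, characterized as the left-invariant Borel probability measure
  on the unitary group. Regularity is automatic, since the group is a compact metric space,
  and left invariance determines the measure uniquely and implies right invariance.
\<close>

definition haar_prob_measure :: "(complex^'d^'d) measure \<Rightarrow> bool" where
  "haar_prob_measure \<mu> \<longleftrightarrow>
     prob_space \<mu> \<and>
     sets \<mu> = sets (restrict_space borel unitary_group) \<and>
     (\<forall>V\<in>unitary_group. distr \<mu> \<mu> (\<lambda>U. V ** U) = \<mu>)"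

definition multi_indices :: "nat \<Rightarrow> ('g::finite \<Rightarrow> nat) set" where
  "multi_indices n = {\<alpha>. (\<Sum>j\<in>UNIV. \<alpha> j) = n}"

definition multinom :: "('g::finite \<Rightarrow> nat) \<Rightarrow> complex" where
  "multinom \<alpha> = fact (\<Sum>j\<in>UNIV. \<alpha> j) / (\<Prod>j\<in>UNIV. fact (\<alpha> j))"

definition monomial_vec :: "complex^'g \<Rightarrow> ('g \<Rightarrow> nat) \<Rightarrow> complex" where
  "monomial_vec x \<alpha> = (\<Prod>j\<in>UNIV. (x $ j) ^ \<alpha> j)"

definition c_coeff :: "nat \<Rightarrow> ('g::finite \<Rightarrow> nat) \<Rightarrow> complex" where
  "c_coeff d \<alpha> = of_nat (d choose (\<Sum>j\<in>UNIV. \<alpha> j)) * multinom \<alpha> *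
     (\<Prod>j\<in>UNIV. inverse (of_nat (d choose \<alpha> j)))"

text \<open>The matrix pencil \<open>I + \<Sum>\<^sub>j x\<^sub>j U\<^sub>j\<close>; the entrywise map is multiplication by the complex
  scalar \<open>x\<^sub>j\<close>, as the library's scaling of matrices is by reals only.\<close>

definition pencil :: "complex^'g \<Rightarrow> ('g \<Rightarrow> complex^'d^'d) \<Rightarrow> complex^'d^'d" where
  "pencil x U = mat 1 + (\<Sum>j\<in>UNIV. map_matrix (\<lambda>z. x $ j * z) (U j))"

end

theory Submission
  imports Defs "HOL-Combinatorics.Multiset_Permutations"
begin

text \<open>
  Expand both determinants over permutations \<open>\<sigma>, \<tau>\<close> and over labellings \<open>f, f'\<close> that say from
  which summand of the pencil each row is taken. By Fubini each term becomes a product over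
  \<open>j\<close> of one-matrix moments. Left multiplication by diagonal sign matrices kills all terms with
  \<open>f \<noteq> f'\<close>. For \<open>f = f'\<close>, averaging over left multiplication by permutation matrices and
  using \<open>U\<^sup>* U = I\<close> shows that, after antisymmetrizing in the rows \<open>S\<close> labelled \<open>j\<close>, the moment
  agrees with \<open>(d - |S|)! / d!\<close> times the indicator of \<open>\<sigma> = \<tau>\<close> on \<open>S\<close>. The sum over
  \<open>\<sigma>, \<tau>\<close> is alternating, so the moments may be replaced by these indicators one \<open>j\<close> at a
  time; only \<open>\<sigma> = \<tau>\<close> survives, and counting labellings gives the coefficients.
\<close>

section \<open>Alternating sums, extensions of permutations and orthonormal columns\<close>

text \<open>A determinant with two equal rows vanishes: right composition with the transposition of
  two indices that \<open>r\<close> identifies reverses the sign and preserves the product.\<close>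

lemma sum_sign_noninj_eq_0:
  fixes M :: "'b \<Rightarrow> 'a \<Rightarrow> 'c::field_char_0"
  assumes "finite S" "\<not> inj_on r S"
  shows "(\<Sum>p | p permutes S. of_int (sign p) * (\<Prod>i\<in>S. M (r i) (p i))) = 0"
    (is "?s = 0")
proof -
  obtain a b where ab: "a \<in> S" "b \<in> S" "a \<noteq> b" "r a = r b"
    using assms by (auto simp: inj_on_def)
  define t where "t = Transposition.transpose a b"
  have t: "t permutes S" unfolding t_def by (rule permutes_swap_id) (use ab in auto)
  have rt: "r (t i) = r i" for i
    using ab by (auto simp: t_def Transposition.transpose_def)
  have tt: "t (t i) = i" for i by (simp add: t_def)
  have sgn: "sign (p \<circ> t) = - sign p" if "p permutes S" for p
  proof -
    have "permutation p" "permutation t"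
      using that t assms(1) by (auto simp: permutation_permutes)
    then show ?thesis using ab by (simp add: sign_compose sign_swap_id t_def)
  qed
  have "?s = (\<Sum>p | p permutes S. of_int (sign (p \<circ> t)) * (\<Prod>i\<in>S. M (r i) ((p \<circ> t) i)))"
    by (rule sum_permutations_compose_right[OF t])
  also have "\<dots> = (\<Sum>p | p permutes S. - (of_int (sign p) * (\<Prod>i\<in>S. M (r i) (p i))))"
  proof (rule sum.cong, simp)
    fix p assume p: "p \<in> {p. p permutes S}"
    \<comment> \<open>Reindexing by \<open>t\<close> cancels the transposition in the column
      argument, and \<open>r\<close> absorbs it in the row argument.\<close>
    have "(\<Prod>i\<in>S. M (r i) ((p \<circ> t) i)) = (\<Prod>i\<in>S. M (r (t i)) ((p \<circ> t) (t i)))"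
      using prod.permute[OF t, of "\<lambda>i. M (r i) ((p \<circ> t) i)"] by (simp add: o_def)
    then show "of_int (sign (p \<circ> t)) * (\<Prod>i\<in>S. M (r i) ((p \<circ> t) i)) =
        - (of_int (sign p) * (\<Prod>i\<in>S. M (r i) (p i)))"
      using p sgn by (simp add: rt tt)
  qed
  also have "\<dots> = - ?s" by (simp add: sum_negf)
  finally have "2 * ?s = 0" by simp
  then show ?thesis by simp
qed

text \<open>One extension \<open>q\<close> comes from any bijection between the complements of
  \<open>S\<close> and of its image. All extensions form the coset of \<open>q\<close> by the
  permutations that fix \<open>S\<close> pointwise.\<close>

lemma card_permutations_extending:
  fixes r :: "'a::finite \<Rightarrow> 'a"
  assumes r: "r \<in> extensional S" "inj_on r S"
  shows "card {p. p permutes UNIV \<and> restrict p S = r} = fact (CARD('a) - card S)"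
proof -
  have "card (- S) = card (- (r ` S))"
    using r by (simp add: Compl_eq_Diff_UNIV card_Diff_subset card_image)
  then obtain h where h: "bij_betw h (- S) (- (r ` S))"
    using bij_betw_iff_card[of "- S" "- (r ` S)"] by auto
  define q where "q = (\<lambda>i. if i \<in> S then r i else h i)"
  have "bij_betw q S (r ` S)" "bij_betw q (- S) (- (r ` S))"
    using r(2) h by (auto simp: q_def bij_betw_def inj_on_def image_def)
  then have "bij_betw q (S \<union> - S) (r ` S \<union> - (r ` S))"
    by (rule bij_betw_combine) auto
  then have q: "bij q" by simp
  have qS: "q i = r i" if "i \<in> S" for i using that by (simp add: q_def)
  have "bij_betw (\<lambda>p. q \<circ> p) {p. p permutes - S} {p. p permutes UNIV \<and> restrict p S = r}"
  proof (rule bij_betwI[where g = "\<lambda>p. inv q \<circ> p"])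
    show "(\<lambda>p. q \<circ> p) \<in> {p. p permutes - S} \<rightarrow> {p. p permutes UNIV \<and> restrict p S = r}"
    proof (intro Pi_I CollectI conjI)
      fix p assume p: "p \<in> {p. p permutes - S}"
      then have "bij (q \<circ> p)" using q by (auto intro: bij_comp dest: permutes_bij)
      then show "q \<circ> p permutes UNIV" by (rule bij_imp_permutes) simp
      show "restrict (q \<circ> p) S = r"
        using p r(1) by (auto simp: fun_eq_iff restrict_def extensional_def qS permutes_not_in)
    qed
    show "(\<lambda>p. inv q \<circ> p) \<in> {p. p permutes UNIV \<and> restrict p S = r} \<rightarrow> {p. p permutes - S}"
    proof (intro Pi_I CollectI)
      fix p assume "p \<in> {p. p permutes UNIV \<and> restrict p S = r}"
      then have p: "bij p" "restrict p S = r" by (auto dest: permutes_bij)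
      have "inv q (p i) = i" if "i \<in> S" for i
        using p(2) that q qS[OF that] by (metis bij_inv_eq_iff restrict_apply')
      moreover have "bij (inv q \<circ> p)" using p q by (simp add: bij_comp bij_imp_bij_inv)
      then have "inv q \<circ> p permutes UNIV" by (rule bij_imp_permutes) simp
      ultimately show "inv q \<circ> p permutes - S"
        by (auto intro: permutes_superset)
    qed
  qed (use q in \<open>simp_all add: fun_eq_iff bij_is_inj bij_is_surj surj_f_inv_f\<close>)
  then have "card {p. p permutes UNIV \<and> restrict p S = r} = card {p. p permutes - S}"
    by (rule bij_betw_same_card[symmetric])
  also have "\<dots> = fact (CARD('a) - card S)"
    by (rule card_permutations) (auto simp: Compl_eq_Diff_UNIV card_Diff_subset)
  finally show ?thesis .
qed

lemma unitary_column_orthonormal: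
  fixes U :: "complex^'d^'d"
  assumes "U \<in> unitary_group"
  shows "(\<Sum>a\<in>UNIV. U $ a $ i * cnj (U $ a $ j)) = (if i = j then 1 else 0)"
proof -
  have "(adjoint_matrix U ** U) $ j $ i = mat 1 $ j $ i"
    using assms by (simp add: unitary_group_def)
  then show ?thesis
    by (simp add: matrix_matrix_mult_def adjoint_matrix_def transpose_def mat_def mult.commute eq_commute)
qed

text \<open>Non-injective row choices cancel by antisymmetry, so the sum over row permutations extends
  to all maps \<open>S \<rightarrow> UNIV\<close>, where it factorizes into inner products of columns.\<close>

lemma sum_row_permutations_unitary:
  fixes U :: "complex^'d^'d"
  assumes U: "U \<in> unitary_group"
  shows "(\<Sum>r | r permutes UNIV. \<Sum>p | p permutes S. of_int (sign p) *
            ((\<Prod>i\<in>S. U $ r i $ \<sigma> (p i)) * cnj (\<Prod>i\<in>S. U $ r i $ \<tau> i))) =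
    fact (CARD('d) - card S) *
      (\<Sum>p | p permutes S. of_int (sign p) * (\<Prod>i\<in>S. if \<sigma> (p i) = \<tau> i then 1 else 0))"
proof -
  define G where "G r = (\<Sum>p | p permutes S. of_int (sign p) *
            ((\<Prod>i\<in>S. U $ r i $ \<sigma> (p i)) * cnj (\<Prod>i\<in>S. U $ r i $ \<tau> i)))" for r
  have G0: "G r = 0" if "\<not> inj_on r S" for r
    using sum_sign_noninj_eq_0[OF _ that, of "\<lambda>a b. U $ a $ \<sigma> b"]
    by (simp add: G_def sum_distrib_right[symmetric] mult.assoc[symmetric])
  have Gr: "G (restrict r S) = G r" for r by (simp add: G_def)
  let ?F = "S \<rightarrow>\<^sub>E (UNIV :: 'd set)"
  have "(\<Sum>r | r permutes UNIV. G r) = (\<Sum>r | r permutes UNIV. G (restrict r S))"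
    by (simp only: Gr)
  also have "\<dots> = (\<Sum>f\<in>?F. \<Sum>r\<in>{r\<in>{r. r permutes UNIV}. restrict r S = f}. G (restrict r S))"
    by (rule sum.group[symmetric]) (auto simp: finite_PiE)
  also have "\<dots> = (\<Sum>f\<in>?F. fact (CARD('d) - card S) * G f)"
  proof (rule sum.cong, simp)
    fix f assume f: "f \<in> ?F"
    have "(\<Sum>r\<in>{r\<in>{r. r permutes UNIV}. restrict r S = f}. G (restrict r S)) =
       of_nat (card {r. r permutes UNIV \<and> restrict r S = f}) * G f"
      by simp
    \<comment> \<open>The extensions are counted only for injective \<open>f\<close>; for all other
      \<open>f\<close> both sides vanish because \<open>G f = 0\<close>.\<close>
    also have "\<dots> = fact (CARD('d) - card S) * G f"
      using f card_permutations_extending[of f S] G0[of f]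
      by (cases "inj_on f S") (auto simp: PiE_def)
    finally show "(\<Sum>r\<in>{r\<in>{r. r permutes UNIV}. restrict r S = f}. G (restrict r S)) =
       fact (CARD('d) - card S) * G f" .
  qed
  also have "\<dots> = fact (CARD('d) - card S) * (\<Sum>f\<in>?F. G f)"
    by (simp add: sum_distrib_left)
  also have "(\<Sum>f\<in>?F. G f) = (\<Sum>p | p permutes S. of_int (sign p) *
      (\<Sum>f\<in>?F. \<Prod>i\<in>S. U $ f i $ \<sigma> (p i) * cnj (U $ f i $ \<tau> i)))"
    unfolding G_def by (subst sum.swap) (simp add: sum_distrib_left prod.distrib)
  also have "\<dots> = (\<Sum>p | p permutes S. of_int (sign p) *
      (\<Prod>i\<in>S. \<Sum>a\<in>UNIV. U $ a $ \<sigma> (p i) * cnj (U $ a $ \<tau> i)))"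
    by (subst prod_sum_PiE) auto
  also have "\<dots> = (\<Sum>p | p permutes S. of_int (sign p) * (\<Prod>i\<in>S. if \<sigma> (p i) = \<tau> i then 1 else 0))"
    by (simp add: unitary_column_orthonormal[OF U])
  finally show ?thesis by (simp add: G_def)
qed

section \<open>Exchange of factors under an alternating sum\<close>

text \<open>The substitution of \<open>s \<circ> p\<close> for \<open>s\<close> multiplies the sign
  by \<open>sign p\<close> and leaves \<open>F\<close> alone. Averaging over all \<open>p\<close>
  therefore shows that the sum depends on \<open>E\<close> only through its antisymmetrization over
  \<open>S\<close>.\<close>

lemma sum_permutations_replace_kernel:
  fixes F E D :: "('a \<Rightarrow> 'a) \<Rightarrow> 'c::field_char_0"
  assumes "finite N" "S \<subseteq> N"
    and F: "\<And>s p. p permutes S \<Longrightarrow> F (s \<circ> p) = F s"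
    and ED: "\<And>s. (\<Sum>p | p permutes S. of_int (sign p) * E (s \<circ> p)) =
                  (\<Sum>p | p permutes S. of_int (sign p) * D (s \<circ> p))"
  shows "(\<Sum>s | s permutes N. of_int (sign s) * (F s * E s)) =
         (\<Sum>s | s permutes N. of_int (sign s) * (F s * D s))"
proof -
  have fS: "finite S" by (rule finite_subset[OF assms(2,1)])
  \<comment> \<open>The averaging identity holds for any kernel \<open>H\<close> and is used for
    both \<open>E\<close> and \<open>D\<close>. Each of the \<open>fact (card S)\<close> copies of
    the sum is shifted by its own \<open>p\<close>.\<close>
  have *: "fact (card S) * (\<Sum>s | s permutes N. of_int (sign s) * (F s * H s)) =
    (\<Sum>s | s permutes N. of_int (sign s) * F s * (\<Sum>p | p permutes S. of_int (sign p) * H (s \<circ> p)))"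
    for H :: "('a \<Rightarrow> 'a) \<Rightarrow> 'c"
  proof -
    have "fact (card S) * (\<Sum>s | s permutes N. of_int (sign s) * (F s * H s)) =
      (\<Sum>p | p permutes S. \<Sum>s | s permutes N. of_int (sign s) * (F s * H s))"
      by (simp add: card_permutations[OF refl fS])
    also have "\<dots> = (\<Sum>p | p permutes S. \<Sum>s | s permutes N.
        of_int (sign s) * of_int (sign p) * (F s * H (s \<circ> p)))"
    proof (rule sum.cong, simp)
      fix p assume "p \<in> {p. p permutes S}"
      then have p: "p permutes S" "p permutes N"
        using permutes_subset assms(2) by auto
      have "sign (s \<circ> p) = sign s * sign p" if "s permutes N" for s
        using that p(2) assms(1) by (intro sign_compose) (auto simp: permutation_permutes)
      then show "(\<Sum>s | s permutes N. of_int (sign s) * (F s * H s)) =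
        (\<Sum>s | s permutes N. of_int (sign s) * of_int (sign p) * (F s * H (s \<circ> p)))"
        using p(1) by (subst sum_permutations_compose_right[OF p(2)], intro sum.cong) (auto simp: F)
    qed
    also have "\<dots> = (\<Sum>s | s permutes N. of_int (sign s) * F s *
        (\<Sum>p | p permutes S. of_int (sign p) * H (s \<circ> p)))"
      by (subst sum.swap) (simp add: sum_distrib_left mult_ac)
    finally show ?thesis .
  qed
  have "fact (card S) * (\<Sum>s | s permutes N. of_int (sign s) * (F s * E s)) =
        fact (card S) * (\<Sum>s | s permutes N. of_int (sign s) * (F s * D s))"
    unfolding * ED ..
  then show ?thesis by simp
qed

text \<open>Kernels are exchanged one at a time. A permutation of \<open>S k\<close> moves no point
  of the other sets, by disjointness, so the remaining factors are invariant under it.\<close>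

lemma sum_permutations_replace_kernels:
  fixes E D :: "'j \<Rightarrow> ('a \<Rightarrow> 'a) \<Rightarrow> 'c::field_char_0"
  assumes "finite N" "finite J" "\<And>j. j \<in> J \<Longrightarrow> S j \<subseteq> N" "disjoint_family_on S J"
    and E: "\<And>j s s'. j \<in> J \<Longrightarrow> (\<And>i. i \<in> S j \<Longrightarrow> s i = s' i) \<Longrightarrow> E j s = E j s'"
    and D: "\<And>j s s'. j \<in> J \<Longrightarrow> (\<And>i. i \<in> S j \<Longrightarrow> s i = s' i) \<Longrightarrow> D j s = D j s'"
    and ED: "\<And>j s. j \<in> J \<Longrightarrow> (\<Sum>p | p permutes S j. of_int (sign p) * E j (s \<circ> p)) =
                  (\<Sum>p | p permutes S j. of_int (sign p) * D j (s \<circ> p))"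
  shows "(\<Sum>s | s permutes N. of_int (sign s) * (\<Prod>j\<in>J. E j s)) =
         (\<Sum>s | s permutes N. of_int (sign s) * (\<Prod>j\<in>J. D j s))"
proof -
  \<comment> \<open>The intermediate sums of the induction have \<open>D\<close> on \<open>K\<close>
    and still \<open>E\<close> on the rest.\<close>
  have "(\<Sum>s | s permutes N. of_int (sign s) * (\<Prod>j\<in>J. E j s)) =
    (\<Sum>s | s permutes N. of_int (sign s) * ((\<Prod>j\<in>K. D j s) * (\<Prod>j\<in>J - K. E j s)))"
    if "K \<subseteq> J" for K
    using finite_subset[OF that assms(2)] that
  proof (induction K rule: finite_induct)
    case (insert k K)
    then have k: "k \<in> J" "K \<subseteq> J" by auto
    define F where "F s = (\<Prod>j\<in>K. D j s) * (\<Prod>j\<in>J - insert k K. E j s)" for s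
    have JK: "J - K = insert k (J - insert k K)" using insert by auto
    have "F (s \<circ> p) = F s" if p: "p permutes S k" for s p
    proof -
      have "(s \<circ> p) i = s i" if "j \<in> J" "j \<noteq> k" "i \<in> S j" for i j
      proof -
        have "i \<notin> S k" using that k assms(4) by (auto simp: disjoint_family_on_def)
        then show ?thesis using p by (simp add: permutes_not_in)
      qed
      then show ?thesis
        unfolding F_def using insert.hyps k
        by (intro arg_cong2[where f = "(*)"] prod.cong refl E D) auto
    qed
    from sum_permutations_replace_kernel[OF assms(1) assms(3)[OF k(1)] this ED[OF k(1)]]
    have "(\<Sum>s | s permutes N. of_int (sign s) * (F s * E k s)) =
         (\<Sum>s | s permutes N. of_int (sign s) * (F s * D k s))" by simp
    then show ?case
      using insert assms(2) k unfolding insert.IH[OF k(2)] JK F_def by (simp add: mult_ac)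
  qed simp
  from this[of J] show ?thesis by simp
qed

text \<open>The sets \<open>S j\<close> cover \<open>N\<close>, and both permutations fix the
  complement of \<open>N\<close>, so the indicators leave only \<open>s = t\<close>. There the two
  signs cancel, and \<open>fact (card N)\<close> equal terms remain.\<close>

lemma sum_permutations_agree:
  fixes N :: "'a set"
  assumes "finite N" "finite J" "\<And>j. j \<in> J \<Longrightarrow> finite (S j)" "(\<Union>j\<in>J. S j) = N"
  shows "(\<Sum>t | t permutes N. \<Sum>s | s permutes N. of_int (sign t) * (of_int (sign s) *
    (\<Prod>j\<in>J. c j * (\<Prod>i\<in>S j. if s i = t i then 1 else 0)))) =
    fact (card N) * (\<Prod>j\<in>J. c j :: 'c::field_char_0)"
proof -
  have eq: "(\<Prod>j\<in>J. c j * (\<Prod>i\<in>S j. if s i = t i then 1 else 0)) =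
    (if s = t then \<Prod>j\<in>J. c j else 0)" if "s permutes N" "t permutes N" for s t
  proof (cases "s = t")
    case False
    then obtain i where i: "s i \<noteq> t i" by auto
    then have "i \<in> N" using that by (metis permutes_not_in)
    then obtain j where j: "j \<in> J" "i \<in> S j" using assms(4) by auto
    have "(\<Prod>i\<in>S j. if s i = t i then 1 else 0 :: 'c) = 0"
      using j i assms(3) by (intro prod_zero) auto
    then have "(\<Prod>j\<in>J. c j * (\<Prod>i\<in>S j. if s i = t i then 1 else 0)) = 0"
      using j assms(2) by (intro prod_zero) auto
    then show ?thesis using False by simp
  qed simp
  have sgn: "of_int (sign t) * of_int (sign t) = (1::'c)" for t :: "'a \<Rightarrow> 'a"
    by (cases t rule: sign_cases) simp_all
  have "(\<Sum>t | t permutes N. \<Sum>s | s permutes N. of_int (sign t) * (of_int (sign s) *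
    (\<Prod>j\<in>J. c j * (\<Prod>i\<in>S j. if s i = t i then 1 else 0)))) =
    (\<Sum>t | t permutes N. \<Sum>s | s permutes N. if s = t then \<Prod>j\<in>J. c j else 0)"
    by (intro sum.cong refl) (simp add: eq sgn)
  also have "\<dots> = (\<Sum>t | t permutes N. \<Prod>j\<in>J. c j)"
    using assms(1) by (intro sum.cong refl) (simp add: finite_permutations)
  finally show ?thesis by (simp add: card_permutations[OF refl assms(1)])
qed

section \<open>Functions with prescribed fibre sizes\<close>

text \<open>Listing the values of \<open>f\<close> along a fixed enumeration of the domain turns
  such functions into the arrangements of the multiset with \<open>b k\<close> copies of each
  \<open>k\<close>, which a multinomial coefficient counts.\<close>

lemma card_functions_with_fibre_sizes:
  fixes b :: "'k::finite \<Rightarrow> nat"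
  assumes "sum b UNIV = CARD('a::finite)"
  shows "card {f :: 'a \<Rightarrow> 'k. \<forall>k. card {i. f i = k} = b k} * (\<Prod>k\<in>UNIV. fact (b k)) = fact (CARD('a))"
proof -
  obtain xs :: "'a list" where xs: "set xs = UNIV" "distinct xs"
    using finite_distinct_list[of "UNIV :: 'a set"] by auto
  have ms: "mset_set UNIV = mset xs" using xs mset_set_set by metis
  have len: "length xs = CARD('a)" using xs distinct_card by metis
  define A where "A = (\<Sum>k\<in>UNIV. replicate_mset (b k) k)"
  have cA: "count A k = b k" for k
    by (simp add: A_def count_sum)
  have sA: "size A = CARD('a)"
    using assms by (simp add: A_def)
  have iff: "(\<forall>k. card {i. f i = k} = b k) \<longleftrightarrow> mset (map f xs) = A" for f :: "'a \<Rightarrow> 'k"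
    using count_image_mset_eq_card_vimage[of "UNIV :: 'a set" f]
    by (auto simp: multiset_eq_iff cA ms)
  have "bij_betw (\<lambda>f. map f xs) {f :: 'a \<Rightarrow> 'k. \<forall>k. card {i. f i = k} = b k} (permutations_of_multiset A)"
  proof (rule bij_betw_imageI)
    show "inj_on (\<lambda>f. map f xs) {f :: 'a \<Rightarrow> 'k. \<forall>k. card {i. f i = k} = b k}"
      using xs by (auto simp: inj_on_def fun_eq_iff)
    show "(\<lambda>f. map f xs) ` {f :: 'a \<Rightarrow> 'k. \<forall>k. card {i. f i = k} = b k} = permutations_of_multiset A"
    proof safe
      fix f :: "'a \<Rightarrow> 'k" assume "\<forall>k. card {i. f i = k} = b k"
      then show "map f xs \<in> permutations_of_multiset A"
        unfolding iff by (simp add: permutations_of_multiset_def)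
    next
      fix ys assume "ys \<in> permutations_of_multiset A"
      then have ys: "mset ys = A" by (rule permutations_of_multisetD)
      then have l: "length xs = length ys" using sA len by (metis size_mset)
      define f where "f = (\<lambda>i. the (map_of (zip xs ys) i))"
      have "map f xs = ys"
        unfolding f_def using l xs(2) by (intro nth_equalityI) (auto simp: map_of_zip_nth)
      then show "ys \<in> (\<lambda>f. map f xs) ` {f :: 'a \<Rightarrow> 'k. \<forall>k. card {i. f i = k} = b k}"
        using iff[of f] ys by (intro image_eqI[of _ _ f]) auto
    qed
  qed
  then have card: "card {f :: 'a \<Rightarrow> 'k. \<forall>k. card {i. f i = k} = b k} = card (permutations_of_multiset A)"
    by (rule bij_betw_same_card)
  \<comment> \<open>Values \<open>k\<close> with \<open>b k = 0\<close> are missing from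
    \<open>set_mset A\<close>, but they only contribute \<open>fact 0 = 1\<close>.\<close>
  have "(\<Prod>k\<in>UNIV. fact (b k)) = (\<Prod>k\<in>set_mset A. fact (count A k) :: nat)"
    by (rule prod.mono_neutral_cong_right) (auto simp: cA not_in_iff)
  then show ?thesis
    using card_permutations_of_multiset_aux[of A] card sA by (simp add: ac_simps)
qed


section \<open>Moments of a single Haar unitary\<close>

lemma space_haar: "haar_prob_measure \<mu> \<Longrightarrow> space \<mu> = unitary_group"
  using sets_eq_imp_space_eq[of \<mu> "restrict_space borel unitary_group"]
  by (simp add: haar_prob_measure_def space_restrict_space)

text \<open>An entry is a coordinate of a column of norm one. The bound makes every moment
  integrable.\<close>

lemma norm_unitary_entry_le_1:
  fixes U :: "complex^'d^'d"
  assumes "U \<in> unitary_group"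
  shows "norm (U $ i $ j) \<le> 1"
proof -
  have "of_real (\<Sum>a\<in>UNIV. (norm (U $ a $ j))\<^sup>2) = (1 :: complex)"
    using unitary_column_orthonormal[OF assms, of j j]
    by (simp only: of_real_sum complex_norm_square) simp
  then have "(\<Sum>a\<in>UNIV. (norm (U $ a $ j))\<^sup>2) = 1"
    by (simp only: of_real_eq_1_iff)
  moreover have "(norm (U $ i $ j))\<^sup>2 \<le> (\<Sum>a\<in>UNIV. (norm (U $ a $ j))\<^sup>2)"
    by (rule member_le_sum) auto
  ultimately show ?thesis using abs_square_le_1[of "norm (U $ i $ j)"] by simp
qed

lemma measurable_haar_entry:
  fixes \<mu> :: "(complex^'d^'d) measure"
  assumes "haar_prob_measure \<mu>"
  shows "(\<lambda>U. U $ i $ j) \<in> borel_measurable \<mu>"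
proof -
  have "(\<lambda>U :: complex^'d^'d. U $ i $ j) \<in> borel_measurable borel"
    by (intro borel_measurable_continuous_onI continuous_intros)
  then have "(\<lambda>U :: complex^'d^'d. U $ i $ j) \<in> borel_measurable (restrict_space borel unitary_group)"
    by (rule measurable_restrict_space1)
  then show ?thesis
    using assms measurable_cong_sets[of \<mu> "restrict_space borel unitary_group" borel borel]
    by (auto simp only: haar_prob_measure_def)
qed

text \<open>The column maps \<open>\<sigma>\<close> and \<open>\<tau>\<close> need not preserve
  \<open>S\<close> and \<open>T\<close>: later they permute all labelled rows, while
  \<open>S\<close> and \<open>T\<close> are the rows of a single label.\<close>

definition moment_integrand :: "'d set \<Rightarrow> 'd set \<Rightarrow> ('d \<Rightarrow> 'd) \<Rightarrow> ('d \<Rightarrow> 'd) \<Rightarrow> complex^'d^'d \<Rightarrow> complex" where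
  "moment_integrand S T \<sigma> \<tau> U = (\<Prod>i\<in>S. U $ i $ \<sigma> i) * cnj (\<Prod>i\<in>T. U $ i $ \<tau> i)"

definition moment :: "(complex^'d^'d) measure \<Rightarrow> 'd set \<Rightarrow> 'd set \<Rightarrow> ('d \<Rightarrow> 'd) \<Rightarrow> ('d \<Rightarrow> 'd) \<Rightarrow> complex" where
  "moment \<mu> S T \<sigma> \<tau> = (\<integral>U. moment_integrand S T \<sigma> \<tau> U \<partial>\<mu>)"

lemma measurable_moment_integrand:
  assumes "haar_prob_measure \<mu>"
  shows "moment_integrand S T \<sigma> \<tau> \<in> borel_measurable \<mu>"
proof -
  have "moment_integrand S T \<sigma> \<tau> =
      (\<lambda>U. (\<Prod>i\<in>S. U $ i $ \<sigma> i) * (\<Prod>i\<in>T. cnj (U $ i $ \<tau> i)))"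
    by (simp add: moment_integrand_def fun_eq_iff)
  moreover have "(\<lambda>U. (\<Prod>i\<in>S. U $ i $ \<sigma> i)) \<in> borel_measurable \<mu>"
    by (intro borel_measurable_prod measurable_haar_entry assms)
  moreover have "(\<lambda>U. (\<Prod>i\<in>T. cnj (U $ i $ \<tau> i))) \<in> borel_measurable \<mu>"
    by (intro borel_measurable_prod borel_measurable_continuous_on[OF _ measurable_haar_entry]
        continuous_intros assms)
  ultimately show ?thesis by (simp only: borel_measurable_times)
qed

lemma integrable_moment_integrand:
  assumes "haar_prob_measure \<mu>"
  shows "integrable \<mu> (moment_integrand S T \<sigma> \<tau>)"
proof -
  interpret prob_space \<mu> using assms by (simp add: haar_prob_measure_def)
  have "norm (moment_integrand S T \<sigma> \<tau> U) \<le> 1" if "U \<in> space \<mu>" for U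
  proof -
    have U: "U \<in> unitary_group" using that space_haar[OF assms] by simp
    have "norm (moment_integrand S T \<sigma> \<tau> U) =
      (\<Prod>i\<in>S. norm (U $ i $ \<sigma> i)) * (\<Prod>i\<in>T. norm (U $ i $ \<tau> i))"
      by (simp add: moment_integrand_def norm_mult flip: prod_norm)
    also have "\<dots> \<le> 1 * 1"
      by (intro mult_mono prod_le_1 prod_nonneg) (auto simp: norm_unitary_entry_le_1[OF U])
    finally show ?thesis by simp
  qed
  then show ?thesis
    by (intro integrable_const_bound[where B = 1] measurable_moment_integrand[OF assms]) auto
qed

text \<open>Multiplication by this matrix from the left puts \<open>s i\<close> times row
  \<open>r i\<close> into row \<open>i\<close>. The case \<open>r = id\<close> gives the diagonal
  sign matrices, the case of constant \<open>s = 1\<close> the permutation matrices.\<close>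

definition monomial_matrix :: "('d \<Rightarrow> complex) \<Rightarrow> ('d \<Rightarrow> 'd) \<Rightarrow> complex^'d^'d" where
  "monomial_matrix s r = (\<chi> i j. if j = r i then s i else 0)"

lemma monomial_matrix_mult: "(monomial_matrix s r ** U) $ i $ j = s i * U $ r i $ j"
  by (simp add: monomial_matrix_def matrix_matrix_mult_def if_distrib[of "\<lambda>z. z * _"] cong: if_cong)

lemma monomial_matrix_unitary:
  assumes "inj r" "\<And>i. s i * cnj (s i) = 1"
  shows "monomial_matrix s r \<in> (unitary_group :: (complex^'d^'d) set)"
proof -
  have "monomial_matrix s r ** adjoint_matrix (monomial_matrix s r) = (mat 1 :: complex^'d^'d)"
    using assms
    by (auto simp: vec_eq_iff monomial_matrix_mult mat_def)
       (auto simp: adjoint_matrix_def transpose_def monomial_matrix_def inj_eq)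
  then show ?thesis
    by (simp add: unitary_group_def matrix_left_right_inverse)
qed

lemma unitary_group_mult:
  assumes "U \<in> unitary_group" "V \<in> unitary_group"
  shows "V ** U \<in> (unitary_group :: (complex^'d^'d) set)"
proof -
  have "adjoint_matrix (V ** U) = adjoint_matrix U ** adjoint_matrix V"
    by (simp add: adjoint_matrix_def transpose_def matrix_matrix_mult_def vec_eq_iff mult.commute)
  then have "adjoint_matrix (V ** U) ** (V ** U) = adjoint_matrix U ** (adjoint_matrix V ** V) ** U"
    by (simp add: matrix_mul_assoc)
  also have "\<dots> = mat 1"
    using assms by (simp add: unitary_group_def)
  finally show ?thesis
    by (simp add: unitary_group_def matrix_left_right_inverse)
qed

lemma integral_haar_left_mult:
  fixes \<mu> :: "(complex^'d^'d) measure" and h :: "complex^'d^'d \<Rightarrow> complex"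
  assumes \<mu>: "haar_prob_measure \<mu>" and V: "V \<in> unitary_group" and h: "h \<in> borel_measurable \<mu>"
  shows "(\<integral>U. h (V ** U) \<partial>\<mu>) = (\<integral>U. h U \<partial>\<mu>)"
proof -
  let ?R = "restrict_space borel (unitary_group :: (complex^'d^'d) set)"
  have sets: "sets \<mu> = sets ?R" using \<mu> by (simp add: haar_prob_measure_def)
  have "(\<lambda>U :: complex^'d^'d. V ** U) \<in> borel_measurable borel"
    unfolding matrix_matrix_mult_def
    by (intro borel_measurable_continuous_onI continuous_on_vec_lambda continuous_intros)
  then have "(\<lambda>U. V ** U) \<in> measurable ?R ?R"
    using V by (intro measurable_restrict_space3) (auto simp: unitary_group_mult)
  then have "(\<lambda>U. V ** U) \<in> measurable \<mu> \<mu>"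
    using measurable_cong_sets[OF sets sets] by simp
  then have "(\<integral>U. h U \<partial>distr \<mu> \<mu> (\<lambda>U. V ** U)) = (\<integral>U. h (V ** U) \<partial>\<mu>)"
    by (rule integral_distr[OF _ h])
  then show ?thesis using \<mu> V by (simp add: haar_prob_measure_def)
qed

text \<open>Changing the sign of a row that belongs to exactly one of \<open>S\<close> and
  \<open>T\<close> negates the integrand, while invariance preserves the integral.\<close>

lemma moment_eq_0:
  assumes \<mu>: "haar_prob_measure \<mu>" and ST: "S \<noteq> T"
  shows "moment \<mu> S T \<sigma> \<tau> = 0"
proof -
  from ST obtain a where a: "a \<in> S \<longleftrightarrow> a \<notin> T" by auto
  define s :: "'a \<Rightarrow> complex" where "s i = (if i = a then -1 else 1)" for i
  have s: "(\<Prod>i\<in>A. s i) = (if a \<in> A then -1 else 1)" for A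
    by (simp add: s_def prod.If_cases prod.delta)
  have cs: "cnj (s i) = s i" for i by (simp add: s_def)
  have V: "monomial_matrix s id \<in> unitary_group"
    by (rule monomial_matrix_unitary) (auto simp: s_def)
  have "moment_integrand S T \<sigma> \<tau> (monomial_matrix s id ** U) = - moment_integrand S T \<sigma> \<tau> U" for U
    using a by (simp add: moment_integrand_def monomial_matrix_mult prod.distrib cs s)
  then have "moment \<mu> S T \<sigma> \<tau> = - moment \<mu> S T \<sigma> \<tau>"
    using integral_haar_left_mult[OF \<mu> V measurable_moment_integrand[OF \<mu>], of S T \<sigma> \<tau>]
    by (simp add: moment_def)
  then show ?thesis by simp
qed

text \<open>Averaging over all permutation matrices replaces the integrand by a sum over row
  permutations, which is constant on the unitary group; dividing by the number of permutations gives
  the factor. The equality need not hold term by term, only after antisymmetrization.\<close>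

lemma moment_antisymmetrized:
  fixes \<mu> :: "(complex^'d^'d) measure"
  assumes \<mu>: "haar_prob_measure \<mu>"
  shows "(\<Sum>p | p permutes S. of_int (sign p) * moment \<mu> S S (\<sigma> \<circ> p) \<tau>) =
    (\<Sum>p | p permutes S. of_int (sign p) * (fact (CARD('d) - card S) / fact CARD('d) *
       (\<Prod>i\<in>S. if (\<sigma> \<circ> p) i = \<tau> i then 1 else 0)))" (is "?l = ?r")
proof -
  interpret prob_space \<mu> using \<mu> by (simp add: haar_prob_measure_def)
  define H where "H U = (\<Sum>p | p permutes S. of_int (sign p) * moment_integrand S S (\<sigma> \<circ> p) \<tau> U)" for U
  define q where "q = (\<Sum>p | p permutes S. of_int (sign p) * (\<Prod>i\<in>S. if \<sigma> (p i) = \<tau> i then 1 else 0 :: complex))"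
  have Hm: "H \<in> borel_measurable \<mu>" unfolding H_def
    by (intro borel_measurable_sum borel_measurable_times borel_measurable_const measurable_moment_integrand[OF \<mu>])
  have l: "?l = (\<integral>U. H U \<partial>\<mu>)"
    unfolding H_def moment_def
    by (simp add: integral_sum integrable_moment_integrand[OF \<mu>])
  have Hi: "integrable \<mu> (\<lambda>U. H (monomial_matrix (\<lambda>_. 1) r ** U))" if "r permutes UNIV" for r
  proof -
    have "inj r" using that by (rule permutes_inj)
    have *: "(\<Prod>i\<in>S. U $ r i $ f i) = (\<Prod>i\<in>r ` S. U $ i $ f (inv r i))" for f and U :: "complex^'d^'d"
      using \<open>inj r\<close> by (subst prod.reindex) (auto simp: inj_on_def inj_def)
    have "moment_integrand S S (\<sigma> \<circ> p) \<tau> (monomial_matrix (\<lambda>_. 1) r ** U) =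
      moment_integrand (r ` S) (r ` S) (\<sigma> \<circ> p \<circ> inv r) (\<tau> \<circ> inv r) U" for p U
      by (simp add: moment_integrand_def monomial_matrix_mult * del: cnj_prod)
    then show ?thesis
      by (simp add: H_def integrable_moment_integrand[OF \<mu>])
  qed
  have "fact CARD('d) * ?l = (\<Sum>r | r permutes (UNIV :: 'd set). \<integral>U. H U \<partial>\<mu>)"
    by (simp add: l card_permutations[OF refl])
  also have "\<dots> = (\<Sum>r | r permutes (UNIV :: 'd set). \<integral>U. H (monomial_matrix (\<lambda>_. 1) r ** U) \<partial>\<mu>)"
    by (intro sum.cong refl integral_haar_left_mult[OF \<mu> _ Hm, symmetric] monomial_matrix_unitary)
       (auto simp: permutes_inj)
  also have "\<dots> = (\<integral>U. (\<Sum>r | r permutes (UNIV :: 'd set). H (monomial_matrix (\<lambda>_. 1) r ** U)) \<partial>\<mu>)"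
    using Hi by (simp add: integral_sum)
  \<comment> \<open>Orthonormality of the columns makes the integrand constant here, so that only
    the total mass of \<open>\<mu>\<close> matters.\<close>
  also have "\<dots> = (\<integral>U. fact (CARD('d) - card S) * q \<partial>\<mu>)"
  proof (rule Bochner_Integration.integral_cong[OF refl])
    fix U assume "U \<in> space \<mu>"
    then have "U \<in> unitary_group" by (simp add: space_haar[OF \<mu>])
    from sum_row_permutations_unitary[OF this, where S = S and \<sigma> = \<sigma> and \<tau> = \<tau>]
    show "(\<Sum>r | r permutes (UNIV :: 'd set). H (monomial_matrix (\<lambda>_. 1) r ** U)) =
      fact (CARD('d) - card S) * q"
      by (simp add: H_def q_def moment_integrand_def monomial_matrix_mult)
  qed
  also have "\<dots> = fact (CARD('d) - card S) * q"
    by (simp add: prob_space)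
  finally have "?l = fact (CARD('d) - card S) / fact CARD('d) * q"
    by (simp add: field_simps)
  also have "\<dots> = ?r"
    by (simp add: q_def sum_distrib_left mult_ac)
  finally show ?thesis .
qed

section \<open>Labellings of rows and the expansion of the determinant\<close>

definition label_count :: "('d::finite \<Rightarrow> 'g option) \<Rightarrow> 'g \<Rightarrow> nat" where
  "label_count f j = card {i. f i = Some j}"

lemma card_labelled:
  fixes f :: "'d::finite \<Rightarrow> 'g::finite option"
  shows "card {i. f i \<noteq> None} = (\<Sum>j\<in>UNIV. label_count f j)"
proof -
  have "{i. f i \<noteq> None} = (\<Union>j\<in>UNIV. {i. f i = Some j})" by auto
  then show ?thesis
    unfolding label_count_def by (simp only:, intro card_UN_disjoint) auto
qed

text \<open>The label \<open>None\<close> stands for the identity summand of the pencil, and \<open>Some j\<close> for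
  \<open>x\<^sub>j U\<^sub>j\<close>; the labelling records which summand each row is taken from.\<close>

lemma det_pencil_expansion:
  fixes x :: "complex^'g" and U :: "'g \<Rightarrow> complex^'d^'d"
  shows "det (pencil x U) = (\<Sum>f\<in>UNIV. monomial_vec x (label_count f) *
    (\<Sum>s | s permutes {i. f i \<noteq> None}. of_int (sign s) *
      (\<Prod>j\<in>UNIV. \<Prod>i | f i = Some j. U j $ i $ s i)))"
proof -
  define T where "T k i a = (case k of None \<Rightarrow> if a = i then 1 else 0 | Some j \<Rightarrow> x $ j * U j $ i $ a)"
    for k :: "'g option" and i a :: 'd
  have UO: "(UNIV :: 'g option set) = insert None (range Some)" by (rule UNIV_option_conv)
  have entry: "pencil x U $ i $ a = (\<Sum>k\<in>UNIV. T k i a)" for i a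
    unfolding UO by (simp add: sum.reindex T_def pencil_def mat_def eq_commute)
  \<comment> \<open>Rows are sorted by label: those labelled \<open>None\<close> force
    \<open>s i = i\<close>, and each row labelled \<open>Some j\<close> contributes one factor
    \<open>x $ j\<close>.\<close>
  have grp: "(\<Prod>i\<in>UNIV. T (f i) i (s i)) =
      (\<Prod>i | f i = None. if s i = i then 1 else 0) *
      (monomial_vec x (label_count f) * (\<Prod>j\<in>UNIV. \<Prod>i | f i = Some j. U j $ i $ s i))" for f s
  proof -
    have "(\<Prod>i\<in>UNIV. T (f i) i (s i)) = (\<Prod>k\<in>UNIV. \<Prod>i | f i = k. T (f i) i (s i))"
      using prod.group[of UNIV UNIV f "\<lambda>i. T (f i) i (s i)"] by simp
    also have "\<dots> = (\<Prod>k\<in>UNIV. \<Prod>i | f i = k. T k i (s i))"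
      by (intro prod.cong) auto
    finally show ?thesis
      unfolding UO
      by (simp add: prod.reindex T_def prod.distrib monomial_vec_def label_count_def)
  qed
  have "det (pencil x U) = (\<Sum>s | s permutes UNIV. \<Sum>f\<in>UNIV. of_int (sign s) * (\<Prod>i\<in>UNIV. T (f i) i (s i)))"
    by (simp add: det_def entry prod_sum_PiE[of UNIV "\<lambda>_. UNIV"] PiE_UNIV_domain sum_distrib_left)
  also have "\<dots> = (\<Sum>f\<in>UNIV. \<Sum>s | s permutes UNIV. of_int (sign s) * (\<Prod>i\<in>UNIV. T (f i) i (s i)))"
    by (rule sum.swap)
  \<comment> \<open>A permutation that moves an unlabelled row meets an off-diagonal zero of the
    identity matrix, so only permutations of the labelled rows survive.\<close>
  also have "\<dots> = (\<Sum>f\<in>UNIV. \<Sum>s | s permutes {i. f i \<noteq> None}. of_int (sign s) *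
      (monomial_vec x (label_count f) * (\<Prod>j\<in>UNIV. \<Prod>i | f i = Some j. U j $ i $ s i)))"
  proof (rule sum.cong[OF refl], rule sum.mono_neutral_cong_right)
    fix f :: "'d \<Rightarrow> 'g option"
    show "{s. s permutes {i. f i \<noteq> None}} \<subseteq> {s. s permutes UNIV}"
      using permutes_subset by blast
    show "\<forall>s\<in>{s. s permutes UNIV} - {s. s permutes {i. f i \<noteq> None}}.
        of_int (sign s) * (\<Prod>i\<in>UNIV. T (f i) i (s i)) = 0"
    proof
      fix s assume "s \<in> {s. s permutes UNIV} - {s. s permutes {i. f i \<noteq> None}}"
      then have s: "s permutes UNIV" "\<not> s permutes {i. f i \<noteq> None}" by auto
      have "\<exists>i. f i = None \<and> s i \<noteq> i"
      proof (rule ccontr)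
        assume "\<not> ?thesis"
        then have "s i = i" if "f i = None" for i using that by blast
        then have "s permutes {i. f i \<noteq> None}"
          by (intro permutes_superset[OF s(1)]) simp
        with s show False by simp
      qed
      then have "(\<Prod>i | f i = None. if s i = i then 1 else 0 :: complex) = 0"
        by (intro prod_zero) auto
      then show "of_int (sign s) * (\<Prod>i\<in>UNIV. T (f i) i (s i)) = 0"
        by (simp add: grp)
    qed
    fix s assume "s \<in> {s. s permutes {i. f i \<noteq> None}}"
    then have "(\<Prod>i | f i = None. if s i = i then 1 else 0 :: complex) = 1"
      by (intro prod.neutral) (auto simp: permutes_not_in)
    then show "of_int (sign s) * (\<Prod>i\<in>UNIV. T (f i) i (s i)) = of_int (sign s) *
      (monomial_vec x (label_count f) * (\<Prod>j\<in>UNIV. \<Prod>i | f i = Some j. U j $ i $ s i))"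
      by (simp add: grp)
  qed (auto simp: finite_permutations)
  also have "\<dots> = (\<Sum>f\<in>UNIV. monomial_vec x (label_count f) *
    (\<Sum>s | s permutes {i. f i \<noteq> None}. of_int (sign s) *
      (\<Prod>j\<in>UNIV. \<Prod>i | f i = Some j. U j $ i $ s i)))"
    by (simp add: sum_distrib_left mult_ac)
  finally show ?thesis .
qed

lemma finite_multi_indices: "finite (multi_indices n :: ('g::finite \<Rightarrow> nat) set)"
proof (rule finite_subset)
  show "(multi_indices n :: ('g \<Rightarrow> nat) set) \<subseteq> UNIV \<rightarrow>\<^sub>E {..n}"
    by (auto simp: multi_indices_def intro: member_le_sum)
qed (simp add: finite_PiE)

text \<open>With \<open>None\<close> as one more label, taken by the remaining
  \<open>CARD('d) - sum \<alpha> UNIV\<close> rows, this is a multinomial coefficient.\<close>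

lemma card_labellings:
  fixes \<alpha> :: "'g::finite \<Rightarrow> nat"
  assumes "sum \<alpha> UNIV \<le> CARD('d::finite)"
  shows "of_nat (card {f :: 'd \<Rightarrow> 'g option. label_count f = \<alpha>}) =
    (fact CARD('d) / (fact (CARD('d) - sum \<alpha> UNIV) * (\<Prod>j\<in>UNIV. fact (\<alpha> j))) :: 'c::field_char_0)"
proof -
  define b where "b k = (case k of None \<Rightarrow> CARD('d) - sum \<alpha> UNIV | Some j \<Rightarrow> \<alpha> j)" for k
  have UO: "(UNIV :: 'g option set) = insert None (range Some)" by (rule UNIV_option_conv)
  have iff: "label_count f = \<alpha> \<longleftrightarrow> (\<forall>k. card {i. f i = k} = b k)" for f :: "'d \<Rightarrow> 'g option"
  proof
    assume f: "label_count f = \<alpha>"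
    have "{i. f i = None} = - {i. f i \<noteq> None}" by auto
    then have "card {i. f i = None} = CARD('d) - sum \<alpha> UNIV"
      using card_labelled[of f] f by (simp add: Compl_eq_Diff_UNIV card_Diff_subset)
    then show "\<forall>k. card {i. f i = k} = b k"
      using f by (auto simp: b_def label_count_def split: option.split)
  next
    assume "\<forall>k. card {i. f i = k} = b k"
    then show "label_count f = \<alpha>" by (simp add: fun_eq_iff label_count_def b_def)
  qed
  have "sum b UNIV = CARD('d)" "(\<Prod>k\<in>UNIV. fact (b k)) =
      fact (CARD('d) - sum \<alpha> UNIV) * (\<Prod>j\<in>UNIV. fact (\<alpha> j) :: nat)"
    using assms unfolding UO by (simp_all add: sum.reindex prod.reindex b_def)
  with card_functions_with_fibre_sizes[of b, where ?'a = 'd]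
  have "card {f :: 'd \<Rightarrow> 'g option. label_count f = \<alpha>} *
     (fact (CARD('d) - sum \<alpha> UNIV) * (\<Prod>j\<in>UNIV. fact (\<alpha> j))) = fact CARD('d)"
    by (simp add: iff)
  then have "of_nat (card {f :: 'd \<Rightarrow> 'g option. label_count f = \<alpha>} *
     (fact (CARD('d) - sum \<alpha> UNIV) * (\<Prod>j\<in>UNIV. fact (\<alpha> j)))) = (of_nat (fact CARD('d)) :: 'c)"
    by (simp only:)
  then show ?thesis by (simp add: field_simps)
qed

section \<open>Integration over independent unitaries\<close>

text \<open>The integers d and g are the cardinalities of the index types \<open>'d\<close> and
  \<open>'g\<close>; both are at least 1 because types are nonempty.\<close>

theorem theorem1p1:
  fixes x y :: "complex^'g"
    and \<mu> :: "(complex^'d^'d) measure"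
  assumes "haar_prob_measure \<mu>"
  shows "(\<integral>U. det (pencil x U) * cnj (det (pencil y U)) \<partial>(\<Pi>\<^sub>M j\<in>(UNIV::'g set). \<mu>)) =
    (\<Sum>n=0..CARD('d). \<Sum>\<alpha>\<in>multi_indices n.
       c_coeff CARD('d) \<alpha> * multinom \<alpha> * monomial_vec x \<alpha> * cnj (monomial_vec y \<alpha>))"
proof -
  interpret prob_space \<mu> using assms by (simp add: haar_prob_measure_def)
  interpret P: product_sigma_finite "\<lambda>_ :: 'g. \<mu>" by standard
  let ?P = "\<Pi>\<^sub>M j\<in>(UNIV::'g set). \<mu>"
  define N where "N f = {i. f i \<noteq> None}" for f :: "'d \<Rightarrow> 'g option"
  define fib where "fib f j = {i. f i = Some j}" for f :: "'d \<Rightarrow> 'g option" and j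
  \<comment> \<open>For k at most d this is the reciprocal of k! times the binomial coefficient of d
    over k, which is how the inverse binomials of \<open>c_coeff\<close> arise.\<close>
  define w :: "nat \<Rightarrow> complex" where "w k = fact (CARD('d) - k) / fact CARD('d)" for k
  define m where "m z f = monomial_vec z (label_count f)" for z :: "complex^'g" and f :: "'d \<Rightarrow> 'g option"
  define I where "I f f' s t U = (\<Prod>j\<in>UNIV. moment_integrand (fib f j) (fib f' j) s t (U j))"
    for f f' s t and U :: "'g \<Rightarrow> complex^'d^'d"
  have int: "integrable ?P (I f f' s t)" for f f' s t
    unfolding I_def
    by (rule P.product_integrable_prod) (auto simp: integrable_moment_integrand[OF assms])
  have val: "(\<integral>U. I f f' s t U \<partial>?P) = (\<Prod>j\<in>UNIV. moment \<mu> (fib f j) (fib f' j) s t)" for f f' s t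
    unfolding I_def moment_def
    by (rule P.product_integral_prod) (auto simp: integrable_moment_integrand[OF assms])
  define K where "K f f' = (\<Sum>t | t permutes N f'. \<Sum>s | s permutes N f. of_int (sign t) * (of_int (sign s) *
      (\<Prod>j\<in>UNIV. moment \<mu> (fib f j) (fib f' j) s t)))" for f f'
  have "(\<integral>U. det (pencil x U) * cnj (det (pencil y U)) \<partial>?P) =
    (\<integral>U. (\<Sum>f\<in>UNIV. \<Sum>f'\<in>UNIV. m x f * cnj (m y f') *
      (\<Sum>t | t permutes N f'. \<Sum>s | s permutes N f. of_int (sign t) * (of_int (sign s) * I f f' s t U))) \<partial>?P)"
  proof (rule Bochner_Integration.integral_cong[OF refl])
    fix U
    have "det (pencil x U) * cnj (det (pencil y U)) = 
      (\<Sum>f\<in>UNIV. \<Sum>f'\<in>UNIV. (m x f * (\<Sum>s | s permutes N f. of_int (sign s) *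
          (\<Prod>j\<in>UNIV. \<Prod>i\<in>fib f j. U j $ i $ s i))) *
        cnj (m y f' * (\<Sum>t | t permutes N f'. of_int (sign t) *
          (\<Prod>j\<in>UNIV. \<Prod>i\<in>fib f' j. U j $ i $ t i))))"
      by (simp only: det_pencil_expansion cnj_sum sum_product m_def N_def fib_def)
    also have "\<dots> = (\<Sum>f\<in>UNIV. \<Sum>f'\<in>UNIV. m x f * cnj (m y f') *
      (\<Sum>t | t permutes N f'. \<Sum>s | s permutes N f. of_int (sign t) * (of_int (sign s) * I f f' s t U)))"
    proof (intro sum.cong refl)
      fix f f'
      let ?a = "\<lambda>s. \<Prod>j\<in>UNIV. \<Prod>i\<in>fib f j. U j $ i $ s i"
      let ?b = "\<lambda>t. \<Prod>j\<in>UNIV. \<Prod>i\<in>fib f' j. U j $ i $ t i"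
      have I: "I f f' s t U = ?a s * cnj (?b t)" for s t
        by (simp add: I_def moment_integrand_def prod.distrib)
      have "(\<Sum>s | s permutes N f. of_int (sign s) * ?a s) * cnj (\<Sum>t | t permutes N f'. of_int (sign t) * ?b t) =
        (\<Sum>t | t permutes N f'. \<Sum>s | s permutes N f. of_int (sign t) * (of_int (sign s) * I f f' s t U))"
        unfolding I cnj_sum sum_product complex_cnj_mult complex_cnj_of_int
        by (subst sum.swap) (simp add: mult_ac)
      then show "(m x f * (\<Sum>s | s permutes N f. of_int (sign s) * ?a s)) *
          cnj (m y f' * (\<Sum>t | t permutes N f'. of_int (sign t) * ?b t)) =
        m x f * cnj (m y f') *
        (\<Sum>t | t permutes N f'. \<Sum>s | s permutes N f. of_int (sign t) * (of_int (sign s) * I f f' s t U))"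
        by (simp only: complex_cnj_mult mult_ac)
    qed
    finally show "det (pencil x U) * cnj (det (pencil y U)) = (\<Sum>f\<in>UNIV. \<Sum>f'\<in>UNIV. m x f * cnj (m y f') *
      (\<Sum>t | t permutes N f'. \<Sum>s | s permutes N f. of_int (sign t) * (of_int (sign s) * I f f' s t U)))" .
  qed
  also have "\<dots> = (\<Sum>f\<in>UNIV. \<Sum>f'\<in>UNIV. m x f * cnj (m y f') * K f f')"
    by (simp add: integral_sum int val K_def)
  also have "\<dots> = (\<Sum>f\<in>UNIV. m x f * cnj (m y f) * K f f)"
  proof (intro sum.cong refl)
    fix f :: "'d \<Rightarrow> 'g option"
    have K0: "K f f' = 0" if ne: "f' \<noteq> f" for f'
    proof -
      \<comment> \<open>Two different labels of a row are not both \<open>None\<close>, so some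
        \<open>j\<close> is the label under exactly one of \<open>f\<close> and
        \<open>f'\<close>.\<close>
      obtain i where "f' i \<noteq> f i" using ne by auto
      then obtain j where "f i = Some j \<longleftrightarrow> f' i \<noteq> Some j"
        by (metis option.exhaust)
      then have "fib f j \<noteq> fib f' j" by (auto simp: fib_def)
      then have "(\<Prod>j\<in>UNIV. moment \<mu> (fib f j) (fib f' j) s t) = 0" for s t
        by (intro prod_zero bexI[of _ j]) (simp_all add: moment_eq_0[OF assms])
      then show ?thesis by (simp add: K_def del: prod_zero_iff)
    qed
    have "(\<Sum>f'\<in>UNIV. m x f * cnj (m y f') * K f f') =
      (\<Sum>f'\<in>UNIV. if f' = f then m x f * cnj (m y f) * K f f else 0)"
      by (intro sum.cong) (auto simp: K0)
    then show "(\<Sum>f'\<in>UNIV. m x f * cnj (m y f') * K f f') = m x f * cnj (m y f) * K f f"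
      by simp
  qed
  also have "\<dots> = (\<Sum>f\<in>UNIV. m x f * cnj (m y f) *
     (fact (\<Sum>j\<in>UNIV. label_count f j) * (\<Prod>j\<in>UNIV. w (label_count f j))))"
  proof (intro sum.cong refl arg_cong2[where f = "(*)"])
    fix f :: "'d \<Rightarrow> 'g option"
    \<comment> \<open>The exchange of moments for indicators takes place in the sum over
      \<open>s\<close>, with \<open>t\<close> held fixed.\<close>
    have "(\<Sum>s | s permutes N f. of_int (sign s) * (\<Prod>j\<in>UNIV. moment \<mu> (fib f j) (fib f j) s t)) =
      (\<Sum>s | s permutes N f. of_int (sign s) *
        (\<Prod>j\<in>UNIV. w (label_count f j) * (\<Prod>i\<in>fib f j. if s i = t i then 1 else 0)))" for t
    proof (rule sum_permutations_replace_kernels[where S = "fib f"])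
      show "disjoint_family_on (fib f) UNIV"
        by (auto simp: disjoint_family_on_def fib_def)
      fix j and s :: "'d \<Rightarrow> 'd"
      show "(\<Sum>p | p permutes fib f j. of_int (sign p) * moment \<mu> (fib f j) (fib f j) (s \<circ> p) t) =
         (\<Sum>p | p permutes fib f j. of_int (sign p) *
            (w (label_count f j) * (\<Prod>i\<in>fib f j. if (s \<circ> p) i = t i then 1 else 0)))"
        using moment_antisymmetrized[OF assms, of "fib f j" s t]
        by (simp add: w_def label_count_def fib_def)
    qed (auto simp: N_def fib_def moment_def moment_integrand_def)
    then have "K f f = (\<Sum>t | t permutes N f. \<Sum>s | s permutes N f. of_int (sign t) * (of_int (sign s) *
      (\<Prod>j\<in>UNIV. w (label_count f j) * (\<Prod>i\<in>fib f j. if s i = t i then 1 else 0))))"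
      by (simp only: K_def sum_distrib_left[symmetric])
    also have "\<dots> = fact (card (N f)) * (\<Prod>j\<in>UNIV. w (label_count f j))"
      by (rule sum_permutations_agree) (auto simp: N_def fib_def)
    finally show "K f f = fact (\<Sum>j\<in>UNIV. label_count f j) * (\<Prod>j\<in>UNIV. w (label_count f j))"
      unfolding N_def card_labelled .
  qed
  also have "\<dots> = (\<Sum>\<alpha>\<in>(\<Union>n\<in>{0..CARD('d)}. multi_indices n). of_nat (card {f :: 'd \<Rightarrow> 'g option. label_count f = \<alpha>}) *
     (monomial_vec x \<alpha> * cnj (monomial_vec y \<alpha>) * (fact (sum \<alpha> UNIV) * (\<Prod>j\<in>UNIV. w (\<alpha> j)))))"
    (is "_ = (\<Sum>\<alpha>\<in>?B. _ * ?G \<alpha>)")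
  proof -
    \<comment> \<open>At most \<open>CARD('d)\<close> rows carry a label, which is why the degrees
      stop at d.\<close>
    have B: "range (label_count :: ('d \<Rightarrow> 'g option) \<Rightarrow> _) \<subseteq> ?B"
    proof (rule image_subsetI)
      fix f :: "'d \<Rightarrow> 'g option"
      have "sum (label_count f) UNIV \<le> CARD('d)"
        unfolding card_labelled[symmetric] by (rule card_mono) auto
      then show "label_count f \<in> ?B" by (simp add: multi_indices_def)
    qed
    have "(\<Sum>f\<in>(UNIV :: ('d \<Rightarrow> 'g option) set). ?G (label_count f)) =
      (\<Sum>\<alpha>\<in>?B. \<Sum>f\<in>{f \<in> (UNIV :: ('d \<Rightarrow> 'g option) set). label_count f = \<alpha>}. ?G (label_count f))"
      by (rule sum.group[symmetric, OF _ _ B]) (simp_all add: finite_multi_indices)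
    also have "\<dots> = (\<Sum>\<alpha>\<in>?B. of_nat (card {f :: 'd \<Rightarrow> 'g option. label_count f = \<alpha>}) * ?G \<alpha>)"
    proof (rule sum.cong[OF refl])
      fix \<alpha>
      have "(\<Sum>f\<in>{f \<in> (UNIV :: ('d \<Rightarrow> 'g option) set). label_count f = \<alpha>}. ?G (label_count f)) =
        (\<Sum>f | label_count (f :: 'd \<Rightarrow> 'g option) = \<alpha>. ?G \<alpha>)"
        by (rule sum.cong) auto
      then show "(\<Sum>f\<in>{f \<in> (UNIV :: ('d \<Rightarrow> 'g option) set). label_count f = \<alpha>}. ?G (label_count f)) =
        of_nat (card {f :: 'd \<Rightarrow> 'g option. label_count f = \<alpha>}) * ?G \<alpha>"
        by (simp only: sum_constant)
    qed
    finally show ?thesis unfolding m_def .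
  qed
  also have "\<dots> = (\<Sum>n=0..CARD('d). \<Sum>\<alpha>\<in>multi_indices n. of_nat (card {f :: 'd \<Rightarrow> 'g option. label_count f = \<alpha>}) * ?G \<alpha>)"
    by (rule sum.UNION_disjoint) (auto simp: finite_multi_indices, auto simp: multi_indices_def)
  also have "\<dots> = (\<Sum>n=0..CARD('d). \<Sum>\<alpha>\<in>multi_indices n.
       c_coeff CARD('d) \<alpha> * multinom \<alpha> * monomial_vec x \<alpha> * cnj (monomial_vec y \<alpha>))"
  proof (intro sum.cong refl)
    fix n and \<alpha> :: "'g \<Rightarrow> nat"
    assume "n \<in> {0..CARD('d)}" "\<alpha> \<in> multi_indices n"
    then have n: "sum \<alpha> UNIV = n" "n \<le> CARD('d)" by (auto simp: multi_indices_def)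
    have le: "\<alpha> j \<le> CARD('d)" for j
      using member_le_sum[of j UNIV \<alpha>] n by simp
    have "(\<Prod>j\<in>UNIV. inverse (of_nat (CARD('d) choose \<alpha> j))) =
      (\<Prod>j\<in>UNIV. fact (\<alpha> j) * w (\<alpha> j))"
      by (simp add: binomial_fact[OF le] w_def)
    also have "\<dots> = (\<Prod>j\<in>UNIV. fact (\<alpha> j)) * (\<Prod>j\<in>UNIV. w (\<alpha> j))"
      by (rule prod.distrib)
    finally have pr: "(\<Prod>j\<in>UNIV. inverse (of_nat (CARD('d) choose \<alpha> j))) =
      (\<Prod>j\<in>UNIV. fact (\<alpha> j)) * (\<Prod>j\<in>UNIV. w (\<alpha> j))" .
    have "(\<Prod>j\<in>UNIV. fact (\<alpha> j)) \<noteq> (0 :: complex)" by simp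
    \<comment> \<open>Apart from the monomials, both sides equal d! n! / ((d-n)! P) times the
      product of all \<open>w (\<alpha> j)\<close>, where P is the product of the factorials of the
      \<open>\<alpha> j\<close>.\<close>
    then show "of_nat (card {f :: 'd \<Rightarrow> 'g option. label_count f = \<alpha>}) * ?G \<alpha> =
      c_coeff CARD('d) \<alpha> * multinom \<alpha> * monomial_vec x \<alpha> * cnj (monomial_vec y \<alpha>)"
      using n unfolding c_coeff_def multinom_def pr
      by (simp add: card_labellings binomial_fact field_simps)
  qed
  finally show ?thesis .
qed

end
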